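(* Let $S=\{x_1,\dots,x_n\}$ be a set of $n$ distinct positive integers which is gcd closed, satisfies the condition $\mathcal G$, and has $\max_{x\in S}|G_S(x)|=3$. Let $a$ and $b$ be positive integers with $a\mid b$. Then the $a$-th power GCD matrix $(S^a)$ divides both the $b$-th power GCD matrix $(S^b)$ and the $b$-th power LCM matrix $[S^b]$ in the ring $M_n(\mathbb Z)$ of $n\times n$ integer matrices.
   Context: For integers $x,y$, $(x,y)$ and $[x,y]$ denote their gcd and lcm. $S$ is gcd closed if $(x_i,x_j)\in S$ for all $1\le i,j\le n$. For $x,y\in S$ with $x<y$, $x$ is a greatest-type divisor of $y$ in $S$ if $x\mid y$ and the conditions $x\mid d\mid y$, $d\in S$ imply $d\in\{x,y\}$; $G_S(y)$ denotes the set of greatest-type divisors of $y$ in $S$. For $x\in S$ with $|G_S(x)|\ge2$, two distinct $y_1,y_2\in G_S(x)$ satisfy the condition $\mathcal G$ if $[y_1,y_2]=x$ and $(y_1,y_2)\in G_S(y_1)\cap G_S(y_2)$; $x$ satisfies $\mathcal G$ if any two distinct elements of $G_S(x)$ satisfy $\mathcal G$; $S$ satisfies $\mathcal G$ if every $x\in S$ has either $|G_S(x)|\le1$, or $|G_S(x)|\ge2$ and $x$ satisfies $\mathcal G$. $(S^a)$ is the $n\times n$ matrix with $(i,j)$-entry $(x_i,x_j)^a$, and $[S^a]$ the $n\times n$ matrix with $(i,j)$-entry $[x_i,x_j]^a$. A matrix $A$ divides $B$ in $M_n(\mathbb Z)$ if there is $C\in M_n(\mathbb Z)$ with $B=AC$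 or $B=CA$. *)

theory Defs
  imports "Jordan_Normal_Form.Matrix"
begin

definition gcd_closed :: "nat set \<Rightarrow> bool" where
  "gcd_closed S \<longleftrightarrow> (\<forall>x\<in>S. \<forall>y\<in>S. gcd x y \<in> S)"

definition greatest_type_divisor :: "nat set \<Rightarrow> nat \<Rightarrow> nat \<Rightarrow> bool" where
  "greatest_type_divisor S x y \<longleftrightarrow>
     x \<in> S \<and> y \<in> S \<and> x < y \<and> x dvd y \<and>
     (\<forall>d\<in>S. x dvd d \<and> d dvd y \<longrightarrow> d \<in> {x, y})"

definition greatest_type_divisors :: "nat set \<Rightarrow> nat \<Rightarrow> nat set" where
  "greatest_type_divisors S y = {x. greatest_type_divisor S x y}"

definition pair_satisfies_G :: "nat set \<Rightarrow> nat \<Rightarrow> nat \<Rightarrow> nat \<Rightarrow> bool" where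
  "pair_satisfies_G S x y1 y2 \<longleftrightarrow>
     lcm y1 y2 = x \<and>
     gcd y1 y2 \<in> greatest_type_divisors S y1 \<inter> greatest_type_divisors S y2"

definition elem_satisfies_G :: "nat set \<Rightarrow> nat \<Rightarrow> bool" where
  "elem_satisfies_G S x \<longleftrightarrow>
     (\<forall>y1\<in>greatest_type_divisors S x. \<forall>y2\<in>greatest_type_divisors S x.
        y1 \<noteq> y2 \<longrightarrow> pair_satisfies_G S x y1 y2)"

definition satisfies_G :: "nat set \<Rightarrow> bool" where
  "satisfies_G S \<longleftrightarrow>
     (\<forall>x\<in>S. card (greatest_type_divisors S x) \<le> 1 \<or>
        (card (greatest_type_divisors S x) \<ge> 2 \<and> elem_satisfies_G S x))"

(* The elements of S are enumerated as x 0, ..., x (n - 1), matching the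
   0-based indices of the matrix type. *)

definition power_gcd_matrix :: "nat \<Rightarrow> (nat \<Rightarrow> nat) \<Rightarrow> nat \<Rightarrow> int mat" where
  "power_gcd_matrix n x a = mat n n (\<lambda>(i, j). int (gcd (x i) (x j)) ^ a)"

definition power_lcm_matrix :: "nat \<Rightarrow> (nat \<Rightarrow> nat) \<Rightarrow> nat \<Rightarrow> int mat" where
  "power_lcm_matrix n x a = mat n n (\<lambda>(i, j). int (lcm (x i) (x j)) ^ a)"

(* Divisibility on either side in the noncommutative ring of n by n integer
   matrices. *)

definition matrix_divides :: "nat \<Rightarrow> int mat \<Rightarrow> int mat \<Rightarrow> bool" where
  "matrix_divides n A B \<longleftrightarrow>
     A \<in> carrier_mat n n \<and> B \<in> carrier_mat n n \<and>
     (\<exists>C\<in>carrier_mat n n. B = A * C \<or> B = C * A)"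

end

theory Submission
  imports Defs
begin

text \<open>Every function \<open>g\<close> on \<open>S\<close> is a divisor sum \<open>g t = (\<Sum>d | d \<in> S \<and> d dvd t. \<beta> d)\<close>. Let \<open>\<alpha>\<close>
  belong to \<open>t ^ a\<close>. If \<open>\<alpha> m dvd \<beta> m\<close> for all \<open>m \<in> S\<close>, then \<open>g\<close> is an integer combination of
  the rows of the power GCD matrix. By inclusion-exclusion over the greatest-type divisors of \<open>m\<close>,
  \<open>\<alpha> m = k ^ a * (\<Prod>p\<in>P. p ^ a - 1)\<close>, where \<open>P\<close> is the set of the cofactors \<open>m div y\<close>, which
  are pairwise coprime by condition \<open>\<G>\<close>, and \<open>m = k * \<Prod>P\<close>. For a row \<open>g\<close> of either target matrix,
  \<open>\<beta> m\<close> is a multiple of \<open>k ^ b * (\<Prod>p\<in>P. p ^ b - 1)\<close> or vanishes.\<close>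

section \<open>Sieved divisor sums\<close>

text \<open>With \<open>Y = {}\<close> this is the divisor sum at \<open>m\<close>; with the
  greatest-type divisors of \<open>m\<close> as \<open>Y\<close> it will isolate
  \<open>\<beta> m\<close>. Enlarging \<open>Y\<close> element by element carries out
  inclusion-exclusion between the two.\<close>

definition sieve_sum :: "nat set \<Rightarrow> (nat \<Rightarrow> int) \<Rightarrow> nat \<Rightarrow> nat set \<Rightarrow> int" where
  "sieve_sum S \<beta> m Y = (\<Sum>d | d \<in> S \<and> d dvd m \<and> (\<forall>y\<in>Y. \<not> d dvd y). \<beta> d)"

text \<open>The summands newly removed by \<open>y\<close> are those whose index divides both
  \<open>m\<close> and \<open>y\<close>, that is, \<open>gcd m y\<close>.\<close>

lemma sieve_sum_insert:
  assumes "finite S"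
  shows "sieve_sum S \<beta> m (insert y Y) = sieve_sum S \<beta> m Y - sieve_sum S \<beta> (gcd m y) Y"
proof -
  let ?A = "\<lambda>m Y. {d. d \<in> S \<and> d dvd m \<and> (\<forall>y\<in>Y. \<not> d dvd y)}"
  have "?A m Y = ?A m (insert y Y) \<union> ?A (gcd m y) Y"
    by auto
  moreover have "sum \<beta> (?A m (insert y Y) \<union> ?A (gcd m y) Y)
    = sum \<beta> (?A m (insert y Y)) + sum \<beta> (?A (gcd m y) Y)"
    by (rule sum.union_disjoint) (use assms in auto)
  ultimately have "sum \<beta> (?A m Y) = sum \<beta> (?A m (insert y Y)) + sum \<beta> (?A (gcd m y) Y)"
    by (rule trans[OF arg_cong])
  then show ?thesis
    by (simp add: sieve_sum_def)
qed

lemma sieve_sum_empty: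
  assumes "finite S"
  shows "sieve_sum S \<beta> t {} = (\<Sum>d\<in>S. if d dvd t then \<beta> d else 0)"
  using sum.inter_filter[OF assms, of \<beta> "\<lambda>d. d dvd t"] by (simp add: sieve_sum_def)

text \<open>The largest element \<open>m\<close> divides no smaller one, so choosing
  \<open>\<beta> m\<close> as the defect at \<open>m\<close> leaves all earlier sums
  unchanged.\<close>

lemma divisor_sum_representation:
  fixes S :: "nat set" and g :: "nat \<Rightarrow> int"
  assumes "finite S" "\<forall>s\<in>S. s > 0"
  shows "\<exists>\<beta>. \<forall>t\<in>S. sieve_sum S \<beta> t {} = g t"
  using assms
proof (induction S rule: finite_linorder_max_induct)
  case (insert m A)
  then obtain \<beta> where \<beta>: "\<forall>t\<in>A. sieve_sum A \<beta> t {} = g t"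
    by auto
  let ?\<beta> = "\<beta>(m := g m - sieve_sum A \<beta> m {})"
  have [simp]: "m \<notin> A"
    using insert.hyps by blast
  have A: "sieve_sum A ?\<beta> t {} = sieve_sum A \<beta> t {}" for t
    unfolding sieve_sum_def by (rule sum.cong) auto
  have "sieve_sum (insert m A) ?\<beta> t {} = g t" if "t \<in> insert m A" for t
  proof (cases "t = m")
    case True
    have "{d. d \<in> insert m A \<and> d dvd m \<and> (\<forall>y\<in>{}. \<not> d dvd y)}
      = insert m {d. d \<in> A \<and> d dvd m \<and> (\<forall>y\<in>{}. \<not> d dvd y)}"
      by auto
    then have "sieve_sum (insert m A) ?\<beta> m {} = ?\<beta> m + sieve_sum A ?\<beta> m {}"
      using insert.hyps by (simp add: sieve_sum_def)
    then show ?thesis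
      using True A by simp
  next
    case False
    then have "t \<in> A" "\<not> m dvd t"
      using that insert.hyps insert.prems by (auto dest!: dvd_imp_le simp: leD)
    then have "{d. d \<in> insert m A \<and> d dvd t \<and> (\<forall>y\<in>{}. \<not> d dvd y)}
      = {d. d \<in> A \<and> d dvd t \<and> (\<forall>y\<in>{}. \<not> d dvd y)}"
      by auto
    then show ?thesis
      using A[of t] \<beta> \<open>t \<in> A\<close> by (simp add: sieve_sum_def)
  qed
  then show ?case
    by blast
qed simp

text \<open>Expanding along \<open>Y\<close> leads from \<open>t\<close> to \<open>gcd t y\<close>,
  again a divisor of \<open>m\<close> in \<open>S\<close>, and taking gcds with \<open>y\<close> and
  with \<open>z\<close> commutes. So invariance passes from \<open>Y = {}\<close> to every
  \<open>Y\<close>.\<close>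

lemma sieve_sum_gcd_invariant:
  assumes "finite S" "gcd_closed S" "finite Y" "Y \<subseteq> S"
    and inv: "\<And>t. t \<in> S \<Longrightarrow> t dvd m \<Longrightarrow> sieve_sum S \<beta> (gcd t z) {} = sieve_sum S \<beta> t {}"
    and "t \<in> S" "t dvd m"
  shows "sieve_sum S \<beta> (gcd t z) Y = sieve_sum S \<beta> t Y"
  using assms(3,4,6,7)
proof (induction Y arbitrary: t)
  case empty
  then show ?case
    using inv by simp
next
  case (insert y Y)
  have "gcd t y \<in> S" "gcd t y dvd m"
    using insert.prems assms(2) by (auto simp: gcd_closed_def intro: dvd_trans)
  then have "sieve_sum S \<beta> (gcd (gcd t y) z) Y = sieve_sum S \<beta> (gcd t y) Y"
    and "sieve_sum S \<beta> (gcd t z) Y = sieve_sum S \<beta> t Y"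
    using insert by auto
  moreover have "gcd (gcd t z) y = gcd (gcd t y) z"
    by (simp only: ac_simps)
  ultimately show ?case
    by (simp only: sieve_sum_insert[OF assms(1)])
qed

text \<open>Inserting \<open>z\<close> into \<open>Y\<close> changes nothing, so the sum subtracted
  at \<open>gcd m z\<close> is 0; by invariance it equals the sum at \<open>m\<close>.\<close>

lemma sieve_sum_eq_0:
  assumes "finite S" "gcd_closed S" "Y \<subseteq> S" "z \<in> Y" "m \<in> S"
    and "\<And>t. t \<in> S \<Longrightarrow> t dvd m \<Longrightarrow> sieve_sum S \<beta> (gcd t z) {} = sieve_sum S \<beta> t {}"
  shows "sieve_sum S \<beta> m Y = 0"
  using sieve_sum_insert[OF assms(1), of \<beta> m z Y] sieve_sum_gcd_invariant[of S Y m \<beta> z m]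
    assms finite_subset[OF assms(3,1)] by (simp add: insert_absorb)

lemma gcd_mult_prod_div:
  fixes q :: nat
  assumes "q dvd M" "coprime p q"
  shows "gcd M (M * p div q) = M div q"
proof (cases "q = 0")
  case False
  from assms obtain r where "M = q * r"
    by blast
  then show ?thesis
    using False assms(2) gcd_mult_left[of r q p]
    by (simp add: coprime_commute mult.assoc coprime_iff_gcd_eq_1 mult.commute)
qed (use assms in simp)

text \<open>Splitting off \<open>p\<close> leaves a difference of two instances for
  \<open>P\<close>, with \<open>k * p\<close> and \<open>k\<close> in place of \<open>k\<close>.
  They differ only in the factors \<open>(k * p) ^ e\<close> and \<open>k ^ e\<close>, whose
  difference supplies \<open>p ^ e - 1\<close>.\<close>

lemma sieve_sum_power:
  fixes k :: nat
  assumes "finite S" "gcd_closed S" "finite P" "pairwise coprime P" "0 \<notin> P"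
    and "k * \<Prod>P \<in> S" "\<And>p. p \<in> P \<Longrightarrow> k * \<Prod>P div p \<in> S"
    and "\<And>t. t \<in> S \<Longrightarrow> k dvd t \<Longrightarrow> t dvd k * \<Prod>P \<Longrightarrow> sieve_sum S \<beta> t {} = c * int t ^ e"
  shows "sieve_sum S \<beta> (k * \<Prod>P) ((\<lambda>p. k * \<Prod>P div p) ` P)
    = c * int k ^ e * (\<Prod>p\<in>P. int p ^ e - 1)"
  using assms(3-)
proof (induction P arbitrary: k)
  case empty
  then show ?case
    by simp
next
  case (insert p P)
  let ?M = "k * \<Prod>P"
  have p: "p > 0" and prod: "\<Prod>(insert p P) = p * \<Prod>P"
    using insert by auto
  have cop: "coprime p q" "q dvd ?M" "?M * p div q = k * \<Prod>(insert p P) div q" if "q \<in> P" for q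
    using insert.prems(1) insert.hyps that
    by (auto simp: pairwise_insert prod ac_simps intro!: dvd_mult dest: dvd_prodI)
  have M: "k * p * \<Prod>P = k * \<Prod>(insert p P)" "k * \<Prod>(insert p P) div p = ?M"
    using p by (simp_all add: prod)
  have gcd: "gcd ?M (k * \<Prod>(insert p P) div q) = ?M div q" if "q \<in> P" for q
    using gcd_mult_prod_div[of q ?M p] cop[OF that] by simp
  have MS: "?M \<in> S"
    using insert.prems(4)[of p] M(2) by simp
  have "sieve_sum S \<beta> (k * p * \<Prod>P) ((\<lambda>q. k * p * \<Prod>P div q) ` P)
    = c * int (k * p) ^ e * (\<Prod>q\<in>P. int q ^ e - 1)"
    using insert.prems insert.hyps
    by (intro insert.IH) (auto simp: M(1) pairwise_insert dest: dvd_mult_left)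
  moreover have "sieve_sum S \<beta> ?M ((\<lambda>q. ?M div q) ` P) = c * int k ^ e * (\<Prod>q\<in>P. int q ^ e - 1)"
  proof (rule insert.IH)
    show "?M div q \<in> S" if "q \<in> P" for q
      using gcd[OF that] MS insert.prems(4)[of q] assms(2) that
      by (metis gcd_closed_def insertCI)
    show "sieve_sum S \<beta> t {} = c * int t ^ e" if "t \<in> S" "k dvd t" "t dvd ?M" for t
      using that by (intro insert.prems(5)) (simp_all add: prod dvd_mult mult.left_commute[of k])
  qed (use insert.prems MS in \<open>auto simp: pairwise_insert\<close>)
  \<comment> \<open>The second instance is still sieved by divisors of the larger product. On
    divisors of \<open>?M\<close> these act like their gcds with \<open>?M\<close>, which are
    \<open>?M div q\<close>.\<close>
  moreover have "sieve_sum S \<beta> ?M ((\<lambda>q. k * \<Prod>(insert p P) div q) ` P)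
    = sieve_sum S \<beta> ?M ((\<lambda>q. ?M div q) ` P)"
  proof -
    have "d dvd k * \<Prod>(insert p P) div q \<longleftrightarrow> d dvd ?M div q" if "q \<in> P" "d dvd ?M" for q d
      using gcd[OF that(1)] that(2) by (metis gcd_greatest_iff)
    then show ?thesis
      unfolding sieve_sum_def by (intro sum.cong) auto
  qed
  moreover have "gcd (k * \<Prod>(insert p P)) ?M = ?M"
    by (simp add: prod gcd_nat.absorb_iff2[symmetric] mult.left_commute)
  ultimately show ?case
    using insert.hyps
    using p by (simp add: sieve_sum_insert[OF assms(1)] M algebra_simps power_mult_distrib)
qed

section \<open>Coprime cofactors and lcm\<close>

text \<open>A common divisor \<open>r\<close> of the cofactors makes \<open>r * y\<close> and
  \<open>r * z\<close>, hence also \<open>r * m\<close>, divide \<open>m\<close>.\<close>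

lemma coprime_div_of_lcm_eq:
  fixes y z m :: nat
  assumes "lcm y z = m" "m > 0"
  shows "coprime (m div y) (m div z)"
proof (rule coprimeI)
  fix r assume "r dvd m div y" "r dvd m div z"
  moreover have "y dvd m" "z dvd m"
    using assms by auto
  moreover from this have "y \<noteq> 0" "z \<noteq> 0"
    using assms(2) by (auto intro!: notI)
  ultimately have "lcm (r * y) (r * z) dvd m"
    by (simp add: dvd_div_iff_mult)
  then have "r * m dvd m"
    using assms(1) by (simp add: lcm_mult_left)
  then show "r dvd 1"
    using assms(2) by simp
qed

text \<open>At each prime \<open>y\<close> or \<open>s\<close> has at least the exponent of
  \<open>m\<close>, hence that of \<open>t\<close>. Without primes: the cofactor \<open>r\<close> of
  \<open>?g\<close> in \<open>t\<close> divides both coprime numbers, so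
  \<open>t = ?g\<close>.\<close>

lemma lcm_gcd_eq_of_coprime:
  fixes m s t y :: nat
  assumes "m > 0" "y dvd m" "t dvd m" "coprime (m div y) (m div gcd s m)"
  shows "lcm s (gcd t y) = lcm s t"
proof -
  let ?g = "lcm (gcd t s) (gcd t y)"
  define r where "r = t div ?g"
  have "t > 0"
    using assms(1,3) by (auto intro: gr0I)
  have r: "?g * r = t"
    unfolding r_def by (simp add: lcm_least)
  have dvd: "r dvd u" if "t dvd u * z" "gcd t z dvd ?g" for u z
  proof -
    have "t dvd gcd (u * t) (u * z)"
      using that by simp
    then have "t dvd u * gcd t z"
      by (simp only: gcd_mult_distrib_nat)
    moreover have "gcd t z * r dvd ?g * r"
      using that(2) by (rule mult_dvd_mono) simp
    then have "gcd t z * r dvd t"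
      by (simp only: r)
    ultimately have "r * gcd t z dvd u * gcd t z"
      using dvd_trans by (simp only: mult.commute[of r]) blast
    then show ?thesis
      using \<open>t > 0\<close> by simp
  qed
  have "r dvd m div y"
    using assms(2,3) by (intro dvd[of _ y]) simp_all
  moreover have "r dvd m div gcd s m"
  proof (rule dvd)
    have "m div gcd s m * gcd s m dvd m div gcd s m * s"
      by (rule mult_dvd_mono) simp_all
    then show "t dvd m div gcd s m * s"
      using assms(3) by (auto intro: dvd_trans)
  qed simp
  ultimately have "r = 1"
    using assms(4) coprime_common_divisor_nat by blast
  then have "t = ?g"
    using r by simp
  also have "?g dvd lcm s (gcd t y)"
    by (auto intro: lcm_least dvd_lcmI1)
  finally show ?thesis
    by (intro dvd_antisym lcm_least) (auto intro: dvd_lcmI2)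
qed

section \<open>Greatest-type divisors under the condition G\<close>

locale G_set =
  fixes S :: "nat set"
  assumes finite: "finite S"
    and pos: "s \<in> S \<Longrightarrow> s > 0"
    and gcd_closed: "gcd_closed S"
    and satisfies_G: "satisfies_G S"
begin

abbreviation "G \<equiv> greatest_type_divisors S"

lemma G_D:
  assumes "y \<in> G m"
  shows "y \<in> S" "m \<in> S" "y < m" "y dvd m"
  using assms by (auto simp: greatest_type_divisors_def greatest_type_divisor_def)

lemma gcd_mem: "s \<in> S \<Longrightarrow> t \<in> S \<Longrightarrow> gcd s t \<in> S"
  using gcd_closed by (simp add: gcd_closed_def)

lemma finite_G: "finite (G m)"
  using finite by (rule finite_subset[rotated]) (auto dest: G_D(1))

lemma pair_satisfies_G:
  assumes "y \<in> G m" "z \<in> G m" "y \<noteq> z"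
  shows "lcm y z = m" "gcd y z \<in> G y" "gcd y z \<in> G z"
proof -
  \<comment> \<open>Two distinct members of \<open>G m\<close> exclude the first alternative of
    \<open>satisfies_G\<close>.\<close>
  have "card {y, z} \<le> card (G m)"
    using assms finite_G by (intro card_mono) auto
  then have "elem_satisfies_G S m"
    using satisfies_G G_D(2)[OF assms(1)] assms(3) by (fastforce simp: satisfies_G_def)
  then show "lcm y z = m" "gcd y z \<in> G y" "gcd y z \<in> G z"
    using assms by (auto simp: elem_satisfies_G_def pair_satisfies_G_def)
qed

text \<open>The largest proper divisor of \<open>m\<close> in \<open>S\<close> above
  \<open>w\<close> works: an element strictly between it and \<open>m\<close> would be larger
  still.\<close>

lemma below_G:
  assumes "m \<in> S" "w \<in> S" "w dvd m" "w \<noteq> m"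
  obtains y where "y \<in> G m" "w dvd y"
proof -
  let ?D = "{d \<in> S. w dvd d \<and> d dvd m \<and> d \<noteq> m}"
  define y where "y = Max ?D"
  have fin: "finite ?D"
    using finite by simp
  moreover have "w \<in> ?D"
    using assms by simp
  ultimately have "Max ?D \<in> ?D"
    by (intro Max_in) blast+
  then have "y \<in> ?D"
    by (simp only: y_def)
  then have y: "y \<in> S" "w dvd y" "y dvd m" "y \<noteq> m"
    by simp_all
  have max: "d \<in> {y, m}" if "d \<in> S" "y dvd d" "d dvd m" for d
  proof (rule ccontr)
    assume "d \<notin> {y, m}"
    moreover have "w dvd d"
      using y(2) that(2) by (rule dvd_trans)
    ultimately have "d \<in> ?D"
      using that by simp
    with fin have "d \<le> y"
      unfolding y_def by (rule Max_ge)
    moreover have "y \<le> d"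
      using that(2) pos[OF that(1)] by (rule dvd_imp_le)
    ultimately show False
      using \<open>d \<notin> {y, m}\<close> by simp
  qed
  have "y < m"
    using dvd_imp_le[OF y(3) pos[OF assms(1)]] y(4) by simp
  then have "y \<in> G m"
    using y(1,3) assms(1) max
    unfolding greatest_type_divisors_def greatest_type_divisor_def by blast
  then show thesis
    using y(2) by (rule that)
qed

text \<open>By \<open>below_G\<close> every proper divisor of \<open>m\<close> in \<open>S\<close>
  is sieved out, so only \<open>m\<close> survives.\<close>

lemma sieve_sum_G:
  assumes "m \<in> S"
  shows "sieve_sum S \<beta> m (G m) = \<beta> m"
proof -
  have "\<not> m dvd y" if "y \<in> G m" for y
    using G_D[OF that] pos by (auto dest: dvd_imp_le simp: leD)
  moreover have "d = m" if "d \<in> S" "d dvd m" "\<forall>y\<in>G m. \<not> d dvd y" for d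
    using below_G[OF assms that(1,2)] that(3) by blast
  ultimately have "{d. d \<in> S \<and> d dvd m \<and> (\<forall>y\<in>G m. \<not> d dvd y)} = {m}"
    using assms by auto
  then show ?thesis
    by (simp add: sieve_sum_def)
qed

text \<open>The induction descends from \<open>m\<close> to another greatest-type divisor \<open>z\<close> above \<open>w\<close>; condition
  \<open>\<G>\<close> says that \<open>gcd y z\<close> has the same cofactor in \<open>z\<close> as \<open>y\<close> has in \<open>m\<close>.\<close>

lemma coprime_cofactors:
  assumes "y \<in> G m" "w \<in> S" "w dvd m" "\<not> w dvd y"
  shows "coprime (m div y) (m div w)"
  using assms
proof (induction m arbitrary: y rule: less_induct)
  case (less m)
  note y = G_D[OF less.prems(1)]
  show ?case
  proof (cases "w = m")
    case True
    then show ?thesis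
      using pos[OF y(2)] by simp
  next
    case False
    then obtain z where z: "z \<in> G m" "w dvd z"
      using below_G y less.prems by metis
    have "y \<noteq> z"
      using z less.prems by blast
    note yz = pair_satisfies_G[OF less.prems(1) z(1) this]
    note zz = G_D[OF z(1)]
    have "coprime (z div gcd y z) (z div w)"
      using less.IH[OF zz(3) yz(3) less.prems(2) z(2)] less.prems(4) by (metis dvd_trans gcd_dvd1)
    moreover have "z div gcd y z = m div y"
    proof -
      have "m * gcd y z = y * z"
        using yz(1) prod_gcd_lcm_nat[of y z] by (simp add: mult.commute)
      moreover have "gcd y z > 0" "y > 0"
        using pos y by auto
      ultimately show ?thesis
        using y(4) by (metis div_mult_mult1 div_mult_mult2 mult.commute neq0_conv)
    qed
    moreover have "coprime (m div y) (m div z)"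
      using coprime_div_of_lcm_eq[OF yz(1)] pos y by simp
    moreover have "m div w = (m div z) * (z div w)"
      using z(2) zz(4) by (metis dvd_div_mult dvd_div_mult_self mult.commute div_mult_swap)
    ultimately show ?thesis
      by simp
  qed
qed

section \<open>Cofactors and the core\<close>

text \<open>Passing to a set merges nothing, because distinct divisors of a positive
  \<open>m\<close> have distinct cofactors.\<close>

definition cofactors :: "nat \<Rightarrow> nat set" where
  "cofactors m = (\<lambda>y. m div y) ` G m"

lemma finite_cofactors: "finite (cofactors m)"
  by (simp add: cofactors_def finite_G)

lemma cofactors_pos: "0 \<notin> cofactors m"
  using G_D pos by (force simp: cofactors_def div_eq_0_iff)

lemma cofactor_dvd: "p \<in> cofactors m \<Longrightarrow> p dvd m"
  using G_D(4) by (auto simp: cofactors_def) (metis dvd_div_mult_self dvd_triv_left)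

lemma pairwise_coprime_cofactors: "pairwise coprime (cofactors m)"
proof (rule pairwiseI)
  fix p q assume "p \<in> cofactors m" "q \<in> cofactors m" "p \<noteq> q"
  then obtain y z where "y \<in> G m" "z \<in> G m" "y \<noteq> z" "p = m div y" "q = m div z"
    by (auto simp: cofactors_def)
  then show "coprime p q"
    using coprime_div_of_lcm_eq[OF pair_satisfies_G(1)] G_D pos by metis
qed

lemma prod_cofactors_dvd:
  assumes "\<And>p. p \<in> cofactors m \<Longrightarrow> p dvd r"
  shows "\<Prod>(cofactors m) dvd r"
proof -
  have "\<Prod>P dvd r" if "P \<subseteq> cofactors m" "finite P" for P
    using that(2,1)
  proof (induction P)
    case (insert p P)
    then have "coprime p (\<Prod>P)"
      by (intro prod_coprime_right pairwiseD[OF pairwise_coprime_cofactors]) auto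
    with insert show ?case
      using assms by (auto intro: divides_mult)
  qed simp
  then show ?thesis
    using finite_cofactors by blast
qed

text \<open>By coprimality of the cofactors this is the gcd of \<open>m\<close> and all members of
  \<open>G m\<close>.\<close>

definition core :: "nat \<Rightarrow> nat" where
  "core m = m div \<Prod>(cofactors m)"

lemma core_mult: "core m * \<Prod>(cofactors m) = m"
proof -
  have "\<Prod>(cofactors m) dvd m"
    by (rule prod_cofactors_dvd) (rule cofactor_dvd)
  then show ?thesis
    by (simp add: core_def)
qed

text \<open>Each cofactor \<open>m div y\<close> divides \<open>m div w\<close>, hence so does their
  product.\<close>

lemma dvd_core:
  assumes "m \<in> S" "w dvd m" "\<And>y. y \<in> G m \<Longrightarrow> w dvd y"
  shows "w dvd core m"
proof -
  have "\<Prod>(cofactors m) dvd m div w"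
  proof (rule prod_cofactors_dvd)
    fix p assume "p \<in> cofactors m"
    then obtain y where y: "y \<in> G m" "p = m div y"
      by (auto simp: cofactors_def)
    then show "p dvd m div w"
      using assms(3)[OF y(1)] G_D(4)[OF y(1)]
      by (metis div_mult_swap dvd_triv_left dvd_div_mult_self)
  qed
  then have "w * \<Prod>(cofactors m) dvd w * (m div w)"
    by (rule mult_dvd_mono[OF dvd_refl])
  then have "w * \<Prod>(cofactors m) dvd core m * \<Prod>(cofactors m)"
    using core_mult assms(2) by simp
  moreover have "\<Prod>(cofactors m) \<noteq> 0"
    using finite_cofactors cofactors_pos by simp
  ultimately show ?thesis
    by simp
qed

section \<open>Divisibility of the summands\<close>

text \<open>This is \<open>sieve_sum_power\<close> with \<open>k = core m\<close> and
  \<open>P = cofactors m\<close>. Only multiples of the core matter, which is what lets the lcm rows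
  fit the form \<open>c * t ^ e\<close>.\<close>

lemma summand_formula:
  assumes "m \<in> S"
    and "\<And>t. t \<in> S \<Longrightarrow> core m dvd t \<Longrightarrow> t dvd m \<Longrightarrow> sieve_sum S \<beta> t {} = c * int t ^ e"
  shows "\<beta> m = c * int (core m) ^ e * (\<Prod>p\<in>cofactors m. int p ^ e - 1)"
proof -
  have div: "m div (m div y) = y" if "y \<in> G m" for y
    using G_D[OF that] pos by (metis div_div_eq_right div_self dvd_refl nat_mult_1 neq0_conv nonzero_mult_div_cancel_left dvd_def)
  have "(\<lambda>y. m div (m div y)) ` G m = G m"
    by (simp add: div)
  then have "(\<lambda>p. core m * \<Prod>(cofactors m) div p) ` cofactors m = G m"
    by (simp only: core_mult) (simp only: cofactors_def image_image)
  moreover have "sieve_sum S \<beta> (core m * \<Prod>(cofactors m))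
      ((\<lambda>p. core m * \<Prod>(cofactors m) div p) ` cofactors m)
    = c * int (core m) ^ e * (\<Prod>p\<in>cofactors m. int p ^ e - 1)"
    using assms div G_D(1)
    by (intro sieve_sum_power finite gcd_closed finite_cofactors pairwise_coprime_cofactors
        cofactors_pos) (auto simp: core_mult, auto simp: cofactors_def)
  ultimately show ?thesis
    by (simp add: core_mult sieve_sum_G assms(1))
qed

text \<open>The sum isolating \<open>\<beta> m\<close> is already sieved by \<open>z\<close>, so
  invariance of \<open>g\<close> under gcd with \<open>z\<close> makes it vanish.\<close>

lemma summand_eq_0:
  assumes "z \<in> G m"
    and "\<And>t. t \<in> S \<Longrightarrow> t dvd m \<Longrightarrow> g (gcd t z) = g t"
    and "\<And>t. t \<in> S \<Longrightarrow> sieve_sum S \<beta> t {} = g t"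
  shows "\<beta> m = 0"
proof -
  note z = G_D[OF assms(1)]
  have "sieve_sum S \<beta> m (G m) = 0"
    using assms z by (intro sieve_sum_eq_0[where z = z] finite gcd_closed)
      (auto dest: G_D simp: gcd_mem)
  then show ?thesis
    by (simp add: sieve_sum_G z)
qed

lemma summand_dvd:
  assumes "m \<in> S" "a dvd b"
    and "\<And>t. t \<in> S \<Longrightarrow> sieve_sum S \<alpha> t {} = int t ^ a"
    and "\<And>t. t \<in> S \<Longrightarrow> core m dvd t \<Longrightarrow> t dvd m \<Longrightarrow> sieve_sum S \<beta> t {} = c * int t ^ b"
    and "b > 0"
  shows "\<alpha> m dvd \<beta> m"
proof -
  from assms(2) obtain r where b: "b = a * r"
    by blast
  have "\<alpha> m = 1 * int (core m) ^ a * (\<Prod>p\<in>cofactors m. int p ^ a - 1)"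
    by (rule summand_formula) (simp_all add: assms)
  moreover have "\<beta> m = c * int (core m) ^ b * (\<Prod>p\<in>cofactors m. int p ^ b - 1)"
    by (rule summand_formula) (simp_all add: assms)
  \<comment> \<open>Geometric series in \<open>p ^ a\<close> with exponent
    \<open>r = b / a\<close>.\<close>
  moreover have "int p ^ a - 1 dvd int p ^ b - 1" for p
    unfolding b power_mult using power_diff_1_eq[of "int p ^ a" r] by simp
  moreover have "int (core m) ^ a dvd c * int (core m) ^ b"
    using assms(2,5) by (auto intro!: dvd_mult le_imp_power_dvd dvd_imp_le)
  ultimately show ?thesis
    by (auto intro!: mult_dvd_mono prod_dvd_prod)
qed

text \<open>If \<open>m\<close> divides \<open>s\<close>, the row is \<open>t ^ b\<close> on
  divisors of \<open>m\<close>. Otherwise some \<open>z\<close> in \<open>G m\<close> lies above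
  \<open>gcd s m\<close>, and the row depends only on \<open>gcd t z\<close> there.\<close>

lemma gcd_summand_dvd:
  assumes "s \<in> S" "m \<in> S" "a dvd b" "b > 0"
    and "\<And>t. t \<in> S \<Longrightarrow> sieve_sum S \<alpha> t {} = int t ^ a"
    and \<beta>: "\<And>t. t \<in> S \<Longrightarrow> sieve_sum S \<beta> t {} = int (gcd s t) ^ b"
  shows "\<alpha> m dvd \<beta> m"
proof (cases "m dvd s")
  case True
  then have "gcd s t = t" if "t dvd m" for t
    using dvd_trans[OF that True] by (simp add: gcd_nat.absorb2)
  then show ?thesis
    using assms by (intro summand_dvd[where c = 1 and a = a and b = b]) auto
next
  case False
  then have "gcd s m \<noteq> m"
    by (metis gcd_dvd1)
  then obtain z where z: "z \<in> G m" "gcd s m dvd z"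
    using below_G[of m "gcd s m"] assms gcd_mem by auto
  have "gcd s (gcd t z) = gcd s t" if "t dvd m" for t
  proof -
    have "gcd s t dvd gcd s m"
      using that by (simp add: dvd_trans[OF gcd_dvd2])
    then have "gcd s t dvd z"
      using z(2) dvd_trans by blast
    then show ?thesis
      by (intro dvd_antisym) (simp_all add: dvd_trans[OF gcd_dvd2])
  qed
  then have "\<beta> m = 0"
    using \<beta> by (intro summand_eq_0[OF z(1), where g = "\<lambda>t. int (gcd s t) ^ b"]) auto
  then show ?thesis
    by simp
qed

text \<open>If \<open>gcd s m\<close> fails to divide some greatest-type divisor \<open>y\<close>, then at each prime of
  \<open>m div y\<close> it has the full exponent of \<open>m\<close>, so \<open>lcm s\<close> does not distinguish \<open>t\<close> from \<open>gcd t y\<close>.\<close>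

lemma lcm_summand_dvd:
  assumes "s \<in> S" "m \<in> S" "a dvd b" "b > 0"
    and "\<And>t. t \<in> S \<Longrightarrow> sieve_sum S \<alpha> t {} = int t ^ a"
    and \<beta>: "\<And>t. t \<in> S \<Longrightarrow> sieve_sum S \<beta> t {} = int (lcm s t) ^ b"
  shows "\<alpha> m dvd \<beta> m"
proof (cases "\<forall>y\<in>G m. gcd s m dvd y")
  case True
  then have core: "gcd s m dvd core m"
    using assms(2) by (intro dvd_core) auto
  \<comment> \<open>Here \<open>gcd s t\<close> is constantly \<open>gcd s m\<close>, so the lcm is
    a constant multiple of \<open>t\<close>; the power of that constant becomes
    \<open>c\<close>.\<close>
  have "lcm s t = s div gcd s m * t" if "core m dvd t" "t dvd m" for t
  proof -
    have "gcd s t = gcd s m"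
      using dvd_trans[OF core that(1)] dvd_trans[OF gcd_dvd2[of s t] that(2)]
      by (intro dvd_antisym) simp_all
    then show ?thesis
      by (metis dvd_div_mult gcd_dvd1 lcm_nat_def)
  qed
  then show ?thesis
    using assms
    by (intro summand_dvd[where c = "int (s div gcd s m) ^ b" and a = a and b = b])
      (auto simp: power_mult_distrib)
next
  case False
  then obtain z where z: "z \<in> G m" "\<not> gcd s m dvd z"
    by blast
  then have "coprime (m div z) (m div gcd s m)"
    using assms gcd_mem by (intro coprime_cofactors) auto
  then have "lcm s (gcd t z) = lcm s t" if "t dvd m" for t
    using that pos assms(2) G_D(4)[OF z(1)] by (intro lcm_gcd_eq_of_coprime[of m]) auto
  then have "\<beta> m = 0"
    using \<beta> by (intro summand_eq_0[OF z(1), where g = "\<lambda>t. int (lcm s t) ^ b"]) auto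
  then show ?thesis
    by simp
qed

section \<open>Integer combinations of GCD rows\<close>

text \<open>Row \<open>d\<close> is the sum of these functions over the divisors of \<open>d\<close>
  in \<open>S\<close>. This system is triangular with unit diagonal, so it can be solved over the
  integers.\<close>

lemma indicator_in_row_span:
  assumes \<alpha>: "\<And>t. t \<in> S \<Longrightarrow> sieve_sum S \<alpha> t {} = int t ^ a"
    and "d \<in> S"
  shows "\<exists>c. \<forall>t\<in>S. (if d dvd t then \<alpha> d else 0) = (\<Sum>k\<in>S. c k * int (gcd k t) ^ a)"
  using assms(2)
proof (induction d rule: less_induct)
  case (less d)
  let ?e = "\<lambda>d t. if d dvd t then \<alpha> d else 0"
  let ?D = "{d' \<in> S. d' dvd d \<and> d' \<noteq> d}"
  have "\<exists>c. \<forall>t\<in>S. ?e d' t = (\<Sum>k\<in>S. c k * int (gcd k t) ^ a)" if "d' \<in> ?D" for d'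
  proof (rule less.IH)
    show "d' < d" "d' \<in> S"
      using that dvd_imp_le[of d' d] pos[OF less.prems] by simp_all
  qed
  then have "\<forall>d'\<in>?D. \<exists>c. \<forall>t\<in>S. ?e d' t = (\<Sum>k\<in>S. c k * int (gcd k t) ^ a)"
    by (rule ballI)
  from bchoice[OF this] obtain c where c: "\<forall>d'\<in>?D. \<forall>t\<in>S.
      ?e d' t = (\<Sum>k\<in>S. c d' k * int (gcd k t) ^ a)"
    by (rule exE)
  \<comment> \<open>Row \<open>d\<close> itself, minus the combinations already found for the proper
    divisors of \<open>d\<close>.\<close>
  have "?e d t = (\<Sum>k\<in>S. ((if k = d then 1 else 0) - (\<Sum>d'\<in>?D. c d' k)) * int (gcd k t) ^ a)"
    if t: "t \<in> S" for t
  proof -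
    let ?row = "\<lambda>k. int (gcd k t) ^ a"
    have "?row d = (\<Sum>d'\<in>S. if d' dvd gcd d t then \<alpha> d' else 0)"
      using \<alpha>[OF gcd_mem[OF less.prems t]] by (simp only: sieve_sum_empty[OF finite])
    also have "\<dots> = (\<Sum>d'\<in>S. if d' dvd d then ?e d' t else 0)"
      by (rule sum.cong) auto
    also have "\<dots> = (\<Sum>d'\<in>{d' \<in> S. d' dvd d}. ?e d' t)"
      by (rule sum.inter_filter[OF finite, symmetric])
    also have "{d' \<in> S. d' dvd d} = insert d ?D"
      using less.prems by auto
    also have "(\<Sum>d'\<in>insert d ?D. ?e d' t) = ?e d t + (\<Sum>d'\<in>?D. ?e d' t)"
      using finite by (intro sum.insert) auto
    also have "(\<Sum>d'\<in>?D. ?e d' t) = (\<Sum>d'\<in>?D. \<Sum>k\<in>S. c d' k * ?row k)"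
      by (rule sum.cong[OF refl]) (rule c[THEN bspec, THEN bspec, OF _ t])
    also have "\<dots> = (\<Sum>k\<in>S. (\<Sum>d'\<in>?D. c d' k) * ?row k)"
      by (subst sum.swap) (simp only: sum_distrib_right)
    finally have "?e d t = ?row d - (\<Sum>k\<in>S. (\<Sum>d'\<in>?D. c d' k) * ?row k)"
      by (simp only: add_diff_cancel_right')
    also have "?row d = (\<Sum>k\<in>S. if k = d then ?row k else 0)"
      using finite less.prems by simp
    also have "\<dots> = (\<Sum>k\<in>S. (if k = d then 1 else 0) * ?row k)"
      by (rule sum.cong) auto
    finally show ?thesis
      by (simp only: left_diff_distrib sum_subtractf)
  qed
  then show ?case
    by (intro exI ballI)
qed

text \<open>The quotients \<open>\<gamma> d\<close> of \<open>\<beta> d\<close> by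
  \<open>\<alpha> d\<close> are the coefficients of \<open>g\<close> with respect to the functions
  of \<open>indicator_in_row_span\<close>.\<close>

lemma row_in_row_span:
  assumes \<alpha>: "\<And>t. t \<in> S \<Longrightarrow> sieve_sum S \<alpha> t {} = int t ^ a"
    and \<beta>: "\<And>t. t \<in> S \<Longrightarrow> sieve_sum S \<beta> t {} = g t"
    and dvd: "\<And>m. m \<in> S \<Longrightarrow> \<alpha> m dvd \<beta> m"
  shows "\<exists>c. \<forall>t\<in>S. g t = (\<Sum>k\<in>S. c k * int (gcd k t) ^ a)"
proof -
  have "\<forall>d\<in>S. \<exists>c. \<forall>t\<in>S. (if d dvd t then \<alpha> d else 0) = (\<Sum>k\<in>S. c k * int (gcd k t) ^ a)"
    using indicator_in_row_span[OF \<alpha>] by (intro ballI)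
  from bchoice[OF this] obtain c where c: "\<forall>d\<in>S. \<forall>t\<in>S.
      (if d dvd t then \<alpha> d else 0) = (\<Sum>k\<in>S. c d k * int (gcd k t) ^ a)"
    by (rule exE)
  have "\<forall>d\<in>S. \<exists>r. \<beta> d = \<alpha> d * r"
    using dvd unfolding dvd_def by blast
  from bchoice[OF this] obtain \<gamma> where \<gamma>: "\<And>d. d \<in> S \<Longrightarrow> \<beta> d = \<alpha> d * \<gamma> d"
    by blast
  have "g t = (\<Sum>k\<in>S. (\<Sum>d\<in>S. \<gamma> d * c d k) * int (gcd k t) ^ a)" if t: "t \<in> S" for t
  proof -
    have "g t = (\<Sum>d\<in>S. if d dvd t then \<beta> d else 0)"
      using \<beta>[OF t] by (simp only: sieve_sum_empty[OF finite])
    also have "\<dots> = (\<Sum>d\<in>S. \<gamma> d * (if d dvd t then \<alpha> d else 0))"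
      by (rule sum.cong) (auto simp: \<gamma>)
    also have "\<dots> = (\<Sum>d\<in>S. \<gamma> d * (\<Sum>k\<in>S. c d k * int (gcd k t) ^ a))"
      by (rule sum.cong[OF refl]) (simp only: c[THEN bspec, THEN bspec, OF _ t])
    also have "\<dots> = (\<Sum>d\<in>S. \<Sum>k\<in>S. \<gamma> d * c d k * int (gcd k t) ^ a)"
      by (simp only: sum_distrib_left mult.assoc)
    also have "\<dots> = (\<Sum>k\<in>S. (\<Sum>d\<in>S. \<gamma> d * c d k) * int (gcd k t) ^ a)"
      by (subst sum.swap) (simp only: sum_distrib_right)
    finally show ?thesis .
  qed
  then show ?thesis
    by (intro exI ballI)
qed

lemma gcd_row_in_span:
  assumes "a dvd b" "b > 0" "s \<in> S"
  shows "\<exists>c. \<forall>t\<in>S. int (gcd s t) ^ b = (\<Sum>k\<in>S. c k * int (gcd k t) ^ a)"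
proof -
  obtain \<alpha> where \<alpha>: "\<And>t. t \<in> S \<Longrightarrow> sieve_sum S \<alpha> t {} = int t ^ a"
    using divisor_sum_representation[OF finite] pos by meson
  obtain \<beta> where \<beta>: "\<And>t. t \<in> S \<Longrightarrow> sieve_sum S \<beta> t {} = int (gcd s t) ^ b"
    using divisor_sum_representation[OF finite] pos by meson
  show ?thesis
    using gcd_summand_dvd[OF assms(3) _ assms(1,2) \<alpha> \<beta>] by (intro row_in_row_span[OF \<alpha> \<beta>])
qed

lemma lcm_row_in_span:
  assumes "a dvd b" "b > 0" "s \<in> S"
  shows "\<exists>c. \<forall>t\<in>S. int (lcm s t) ^ b = (\<Sum>k\<in>S. c k * int (gcd k t) ^ a)"
proof -
  obtain \<alpha> where \<alpha>: "\<And>t. t \<in> S \<Longrightarrow> sieve_sum S \<alpha> t {} = int t ^ a"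
    using divisor_sum_representation[OF finite] pos by meson
  obtain \<beta> where \<beta>: "\<And>t. t \<in> S \<Longrightarrow> sieve_sum S \<beta> t {} = int (lcm s t) ^ b"
    using divisor_sum_representation[OF finite] pos by meson
  show ?thesis
    using lcm_summand_dvd[OF assms(3) _ assms(1,2) \<alpha> \<beta>] by (intro row_in_row_span[OF \<alpha> \<beta>])
qed

end

section \<open>Passage to matrices\<close>

text \<open>The coefficients for each row of the target form a row of a left factor
  \<open>C\<close>, giving the alternative \<open>B = C * A\<close>. Injectivity turns sums over
  \<open>S\<close> into sums over indices.\<close>

lemma matrix_divides_of_row_span:
  assumes "inj_on x {..<n}"
    and "\<And>s. s \<in> x ` {..<n} \<Longrightarrow>
      \<exists>c. \<forall>t\<in>x ` {..<n}. g s t = (\<Sum>k\<in>x ` {..<n}. c k * int (gcd k t) ^ a)"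
  shows "matrix_divides n (power_gcd_matrix n x a) (mat n n (\<lambda>(i, j). g (x i) (x j)))"
proof -
  have "\<forall>s\<in>x ` {..<n}. \<exists>c. \<forall>t\<in>x ` {..<n}.
      g s t = (\<Sum>k\<in>x ` {..<n}. c k * int (gcd k t) ^ a)"
    using assms(2) by (rule ballI)
  from bchoice[OF this] obtain c where c: "\<And>s t. s \<in> x ` {..<n} \<Longrightarrow> t \<in> x ` {..<n} \<Longrightarrow>
      g s t = (\<Sum>k\<in>x ` {..<n}. c s k * int (gcd k t) ^ a)"
    by blast
  have "mat n n (\<lambda>(i, j). g (x i) (x j))
    = mat n n (\<lambda>(i, j). c (x i) (x j)) * power_gcd_matrix n x a"
    by (rule eq_matI)
      (simp_all add: power_gcd_matrix_def scalar_prod_def c sum.reindex[OF assms(1)]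
        atLeast0LessThan)
  moreover have "mat n n (\<lambda>(i, j). c (x i) (x j)) \<in> carrier_mat n n"
    by simp
  ultimately show ?thesis
    by (auto simp: matrix_divides_def power_gcd_matrix_def)
qed

theorem theorem1p2:
  fixes n :: nat and x :: "nat \<Rightarrow> nat" and S :: "nat set" and a b :: nat
  assumes "n \<ge> 1"
    and "inj_on x {..<n}"
    and "S = x ` {..<n}"
    and "\<forall>s\<in>S. s > 0"
    and "gcd_closed S"
    and "satisfies_G S"
    and "Max ((\<lambda>s. card (greatest_type_divisors S s)) ` S) = 3"
    and "a > 0" and "b > 0" and "a dvd b"
  shows "matrix_divides n (power_gcd_matrix n x a) (power_gcd_matrix n x b) \<and>
         matrix_divides n (power_gcd_matrix n x a) (power_lcm_matrix n x b)"
proof -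
  interpret G_set S
    using assms by unfold_locales auto
  have "matrix_divides n (power_gcd_matrix n x a)
      (mat n n (\<lambda>(i, j). int (gcd (x i) (x j)) ^ b))"
    using gcd_row_in_span[of a b] assms(2,3,9,10)
    by (intro matrix_divides_of_row_span[where g = "\<lambda>s t. int (gcd s t) ^ b"]) auto
  moreover have "matrix_divides n (power_gcd_matrix n x a)
      (mat n n (\<lambda>(i, j). int (lcm (x i) (x j)) ^ b))"
    using lcm_row_in_span[of a b] assms(2,3,9,10)
    by (intro matrix_divides_of_row_span[where g = "\<lambda>s t. int (lcm s t) ^ b"]) auto
  ultimately show ?thesis
    by (simp only: power_gcd_matrix_def[of n x b] power_lcm_matrix_def)
qed

end
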